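(* Let $F=f+\psi$, the prox function $d$, the constant $\sigma_d(\psi)\ge 0$, a minimizer $x^*$ of $F$ and $F^*=F(x^* )$ be as in the context. Assume that for some $p\ge 1$ the function $d$ is uniformly convex of degree $p+1$ with respect to $\|\cdot\|$ with constant $\sigma_{p+1}(d)>0$, i.e. $\beta_d(x;y)\ge \frac{\sigma_{p+1}(d)}{p+1}\|x-y\|^{p+1}$ for all $x,y\in\operatorname{dom} d$. Let $\{x_k\},\{v_k\},\{A_k\},\{\gamma_k\}$ be generated by the Contracting Proximal Method (described in the context) with accuracies $\delta_k\ge 0$. Then for all $k\ge 0$ $$A_k\bigl(F(x_k)-F^*\bigr)+\gamma_k\beta_d(v_k;x^* )+\sum_{i=1}^k\gamma_{i-1}\,\beta_d(v_{i-1};v_i)\;\le\; R_k(p,\delta),$$ where $$R_k(p,\delta)=\left(\bigl(\gamma_0\beta_d(x_0;x^* )\bigr)^{\frac{p}{p+1}}+\Bigl(\frac{p+1}{\sigma_{p+1}(d)}\Bigr)^{\frac1{p+1}}\sum_{i=1}^k\frac{\delta_i}{\gamma_i^{1/(p+1)}}\right)^{\frac{p+1}{p}}.$$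
   Context: $\mathbb{E}$ is a finite-dimensional real vector space with an arbitrary norm $\|\cdot\|$; $\mathbb{E}^*$ is its dual with dual norm $\|s\|_*=\sup\{\langle s,h\rangle:\|h\|\le 1\}$. Problem: minimize $F(x)=f(x)+\psi(x)$ over $x\in\operatorname{dom}F$, where $f$ is convex and several times differentiable on its open domain, $\psi:\mathbb{E}\to\mathbb{R}\cup\{+\infty\}$ is proper closed convex (possibly nondifferentiable), and $\operatorname{dom}\psi\subset\operatorname{dom}f$. A solution $x^*\in\operatorname{dom}F$ exists, and $F^*=F(x^* )$. The prox function $d:\operatorname{dom}\psi\to\mathbb{R}$ is differentiable and strictly convex; its Bregman divergence is $\beta_d(x;y)=d(y)-d(x)-\langle\nabla d(x),y-x\rangle$. The constant $\sigma_d(\psi)\ge 0$ is such that $\psi(y)-\psi(x)-\langle\psi'(x),y-x\rangle\ge\sigma_d(\psi)\beta_d(x;y)$ for all $x,y\in\operatorname{dom}\psi$ and all $\psi'(x)\in\partial\psi(x)$ ($\sigma_d(\psi)=0$ is always admissible). Contracting Proximal Method. Choose $x_0\in\operatorname{dom}\psi$, $\gamma_0>0$; set $v_0=x_0$, $A_0=0$. For each $k\ge 0$: (1) choose $a_{k+1}>0$ and set $A_{k+1}=A_k+a_{k+1}$; (2) let $h_{k+1}(x)=A_{k+1}f\bigl(\frac{a_{k+1}x+A_kx_k}{A_{k+1}}\bigr)+a_{k+1}\psi(x)+\gamma_k\beta_d(v_k;x)$; (3) choose an accuracy $\delta_{k+1}\ge 0$; (4) find $v_{k+1}\in\operatorname{dom}\psi$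 such that there is $s\in\partial h_{k+1}(v_{k+1})$ with $\|s\|_*\le\delta_{k+1}$; (5) set $x_{k+1}=\frac{a_{k+1}v_{k+1}+A_kx_k}{A_{k+1}}$; (6) set $\gamma_{k+1}=\gamma_k+a_{k+1}\sigma_d(\psi)$. *)

theory Defs
  imports "HOL-Analysis.Analysis"
begin

definition edom :: "('a \<Rightarrow> ereal) \<Rightarrow> 'a set" where
  "edom g = {x. g x < \<infinity>}"

definition proper_closed_convex :: "('a::real_normed_vector \<Rightarrow> ereal) \<Rightarrow> bool" where
  "proper_closed_convex g \<longleftrightarrow>
     (\<forall>x. g x \<noteq> -\<infinity>) \<and> edom g \<noteq> {} \<and>
     closed {(x, t::real). g x \<le> ereal t} \<and> convex {(x, t::real). g x \<le> ereal t}"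

(* The dual space is the type of bounded linear functionals; its norm is the operator norm,
   which is the dual norm. *)
definition subdifferential ::
    "('a::real_normed_vector \<Rightarrow> ereal) \<Rightarrow> 'a \<Rightarrow> ('a \<Rightarrow>\<^sub>L real) set" where
  "subdifferential g x = {s. \<forall>y. g y \<ge> g x + ereal (blinfun_apply s (y - x))}"

(* On an open set of a finite-dimensional space, a function is (n+1) times differentiable iff
   it is differentiable and all its directional derivatives are n times differentiable. *)
primrec times_differentiable_on ::
    "nat \<Rightarrow> ('a::real_normed_vector \<Rightarrow> real) \<Rightarrow> 'a set \<Rightarrow> bool" where
  "times_differentiable_on 0 f S = True"
| "times_differentiable_on (Suc n) f S =
     ((\<forall>x\<in>S. f differentiable (at x)) \<and>
      (\<forall>u. times_differentiable_on n (\<lambda>x. frechet_derivative f (at x) u) S))"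

definition strictly_convex_on :: "'a::real_vector set \<Rightarrow> ('a \<Rightarrow> real) \<Rightarrow> bool" where
  "strictly_convex_on S f \<longleftrightarrow> convex S \<and>
     (\<forall>x\<in>S. \<forall>y\<in>S. \<forall>t. x \<noteq> y \<longrightarrow> 0 < t \<longrightarrow> t < 1 \<longrightarrow>
        f ((1 - t) *\<^sub>R x + t *\<^sub>R y) < (1 - t) * f x + t * f y)"

(* d is differentiable relative to S, with gradient field gd. If S has empty interior, gd x is
   not unique, but its values on the directions y - x with y in the convex set S are, and the
   Bregman divergence below uses only these. *)
definition has_gradient_on ::
    "('a::real_normed_vector \<Rightarrow> real) \<Rightarrow> ('a \<Rightarrow> 'a \<Rightarrow>\<^sub>L real) \<Rightarrow> 'a set \<Rightarrow> bool" where
  "has_gradient_on d gd S \<longleftrightarrow>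
     (\<forall>x\<in>S. (d has_derivative blinfun_apply (gd x)) (at x within S))"

definition bregman ::
    "('a::real_normed_vector \<Rightarrow> real) \<Rightarrow> ('a \<Rightarrow> 'a \<Rightarrow>\<^sub>L real) \<Rightarrow> 'a \<Rightarrow> 'a \<Rightarrow> real" where
  "bregman d gd x y = d y - d x - blinfun_apply (gd x) (y - x)"

(* f and d are total functions whose values matter only on dom f and dom psi. For psi convex
   with dom psi contained in dom f, the two functions below are infinite off dom psi, and on
   dom psi they evaluate f and d only where these are meaningful (xk and vk lie in dom psi). *)
definition objective ::
    "('a \<Rightarrow> real) \<Rightarrow> ('a \<Rightarrow> ereal) \<Rightarrow> 'a \<Rightarrow> ereal" where
  "objective f \<psi> x = ereal (f x) + \<psi> x"

(* A and a stand for A_k and a_(k+1), so that A + a is A_(k+1). *)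
definition contracted_objective ::
    "('a::real_normed_vector \<Rightarrow> real) \<Rightarrow> ('a \<Rightarrow> ereal) \<Rightarrow> ('a \<Rightarrow> real) \<Rightarrow> ('a \<Rightarrow> 'a \<Rightarrow>\<^sub>L real) \<Rightarrow>
     real \<Rightarrow> real \<Rightarrow> real \<Rightarrow> 'a \<Rightarrow> 'a \<Rightarrow> 'a \<Rightarrow> ereal" where
  "contracted_objective f \<psi> d gd a A \<gamma> xk vk y =
     ereal ((A + a) * f ((1 / (A + a)) *\<^sub>R (a *\<^sub>R y + A *\<^sub>R xk)))
       + ereal a * \<psi> y + ereal (\<gamma> * bregman d gd vk y)"

definition contracting_proximal_method ::
    "('a::real_normed_vector \<Rightarrow> real) \<Rightarrow> ('a \<Rightarrow> ereal) \<Rightarrow> ('a \<Rightarrow> real) \<Rightarrow> ('a \<Rightarrow> 'a \<Rightarrow>\<^sub>L real) \<Rightarrow>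
     real \<Rightarrow> (nat \<Rightarrow> real) \<Rightarrow> (nat \<Rightarrow> real) \<Rightarrow> (nat \<Rightarrow> real) \<Rightarrow> (nat \<Rightarrow> real) \<Rightarrow>
     (nat \<Rightarrow> 'a) \<Rightarrow> (nat \<Rightarrow> 'a) \<Rightarrow> bool" where
  "contracting_proximal_method f \<psi> d gd \<sigma> \<delta> a A \<gamma> x v \<longleftrightarrow>
     x 0 \<in> edom \<psi> \<and> \<gamma> 0 > 0 \<and> v 0 = x 0 \<and> A 0 = 0 \<and>
     (\<forall>k. a (Suc k) > 0 \<and> A (Suc k) = A k + a (Suc k) \<and>
          \<delta> (Suc k) \<ge> 0 \<and>
          v (Suc k) \<in> edom \<psi> \<and>
          (\<exists>s \<in> subdifferential
                 (contracted_objective f \<psi> d gd (a (Suc k)) (A k) (\<gamma> k) (x k) (v k)) (v (Suc k)).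
             norm s \<le> \<delta> (Suc k)) \<and>
          x (Suc k) = (1 / A (Suc k)) *\<^sub>R (a (Suc k) *\<^sub>R v (Suc k) + A k *\<^sub>R x k) \<and>
          \<gamma> (Suc k) = \<gamma> k + a (Suc k) * \<sigma>)"

end

theory Submission
  imports Defs
begin

text \<open>
  The proof is a potential-function argument. Put
  \[ E_k = A_k (F(x_k) - F^*) + \gamma_k \beta_d(v_k; x^*)
           + \sum_{i=1}^k \gamma_{i-1} \beta_d(v_{i-1}; v_i). \]
  The function \<open>h\<^sub>k\<^sub>+\<^sub>1\<close> minimized in a step is not only convex: it grows away from the approximate
  minimizer \<open>v\<^sub>k\<^sub>+\<^sub>1\<close> at least as fast as its linear lower bound \<open>s\<close> plus
  \<open>\<gamma>\<^sub>k\<^sub>+\<^sub>1\<close> times the divergence of \<open>d\<close>. Here \<open>\<gamma>\<^sub>k\<close> is contributed by the proximal term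
  (exactly, by the three-point identity), and \<open>a\<^sub>k\<^sub>+\<^sub>1 * \<sigma>\<close> by \<open>\<psi>\<close>; for the latter one has to extract
  from \<open>s\<close> a genuine subgradient of \<open>\<psi>\<close>, which is possible because the remaining summands of
  \<open>h\<^sub>k\<^sub>+\<^sub>1\<close> are differentiable (\<open>subgradient_of_convex_part\<close>, \<open>contracted_growth\<close>). Evaluating
  this growth at \<open>x\<^sup>*\<close>, and using convexity of \<open>f\<close> at the contracted point and of \<open>\<psi>\<close>
  at \<open>x\<^sub>k\<^sub>+\<^sub>1\<close>, gives
  \[ E_{k+1} \le E_k + \delta_{k+1} \|v_{k+1} - x^*\| \]
  (\<open>contracting_step\<close>).

  By uniform convexity the distance on the right is at most a constant times
  \<open>\<beta>\<^sub>d(v\<^sub>k\<^sub>+\<^sub>1; x\<^sup>*)\<close> to the power \<open>1/(p+1)\<close>, and this divergence is itself at most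
  \<open>E\<^sub>k\<^sub>+\<^sub>1 / \<gamma>\<^sub>k\<^sub>+\<^sub>1\<close>. The resulting inequality is implicit in \<open>E\<^sub>k\<^sub>+\<^sub>1\<close>, but dividing it by
  \<open>E\<^sub>k\<^sub>+\<^sub>1\<close> to the power \<open>1/(p+1)\<close> shows that \<open>E\<^sub>k\<close> to the power \<open>p/(p+1)\<close> grows at most
  additively (\<open>implicit_recursion_bound\<close>).
\<close>

section \<open>Subgradients of a convex function plus a differentiable one\<close>

text \<open>
  Convexity bounds the increment of \<open>q\<close> along the segment from \<open>v\<close> to \<open>y\<close> by a linear function of
  the step \<open>t\<close>, so after division by \<open>t\<close> only the difference quotient of \<open>\<phi>\<close> depends on \<open>t\<close>; let
  \<open>t\<close> tend to \<open>0\<close>. The derivative relative to \<open>S\<close> suffices, since the segment stays in \<open>S\<close>.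
\<close>

lemma subgradient_of_convex_part:
  fixes q \<phi> :: "'a::real_normed_vector \<Rightarrow> real" and s :: "'a \<Rightarrow>\<^sub>L real"
  assumes q: "convex_on S q" and v: "v \<in> S" and y: "y \<in> S"
    and deriv: "(\<phi> has_derivative \<phi>') (at v within S)"
    and sub: "\<And>z. z \<in> S \<Longrightarrow> \<phi> z + q z \<ge> \<phi> v + q v + s (z - v)"
  shows "q y \<ge> q v + s (y - v) - \<phi>' (y - v)"
proof -
  define c where "c t = v + t *\<^sub>R (y - v)" for t :: real
  have conv: "convex S" using q by (rule convex_on_imp_convex)
  have c_alt: "c t = (1 - t) *\<^sub>R v + t *\<^sub>R y" for t
    by (simp add: c_def algebra_simps)
  have c_in: "c t \<in> S" if "t \<in> {0..1}" for t
    using that conv v y by (auto simp: c_alt intro!: convexD)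
  have "(c has_derivative (\<lambda>t. t *\<^sub>R (y - v))) (at 0 within {0..1})"
    unfolding c_def by (auto intro!: derivative_eq_intros)
  moreover have "(\<phi> has_derivative \<phi>') (at (c 0) within c ` {0..1})"
    using deriv c_in by (auto simp: c_def intro: has_derivative_subset)
  ultimately have "((\<phi> \<circ> c) has_derivative (\<phi>' \<circ> (\<lambda>t. t *\<^sub>R (y - v)))) (at 0 within {0..1})"
    by (intro diff_chain_within)
  moreover have "(\<phi>' \<circ> (\<lambda>t. t *\<^sub>R (y - v))) = (*) (\<phi>' (y - v))"
    using has_derivative_linear[OF deriv] by (auto simp: linear_cmul)
  ultimately have "((\<phi> \<circ> c) has_field_derivative \<phi>' (y - v)) (at 0 within {0..1})"
    by (simp add: has_field_derivative_def)
  then have lim: "((\<lambda>t. (\<phi> (c t) - \<phi> v) / t) \<longlongrightarrow> \<phi>' (y - v)) (at 0 within {0..1})"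
    by (simp add: has_field_derivative_iff c_def)
  have quot: "s (y - v) - (q y - q v) \<le> (\<phi> (c t) - \<phi> v) / t" if t: "t \<in> {0<..1}" for t
  proof -
    have "q (c t) \<le> (1 - t) * q v + t * q y"
      unfolding c_alt using t by (intro convex_onD[OF q]) (auto simp: v y)
    moreover have "\<phi> (c t) + q (c t) \<ge> \<phi> v + q v + t * s (y - v)"
      using sub[OF c_in, of t] t by (simp add: c_def blinfun.scaleR_right)
    ultimately have "t * (s (y - v) - (q y - q v)) \<le> \<phi> (c t) - \<phi> v"
      by (simp add: algebra_simps)
    then show ?thesis using t by (simp add: field_simps)
  qed
  have "\<forall>\<^sub>F t in at 0 within {0..1}. s (y - v) - (q y - q v) \<le> (\<phi> (c t) - \<phi> v) / t"
    unfolding eventually_at by (rule exI[of _ 1]) (auto intro!: quot)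
  moreover have "at 0 within {0..1::real} \<noteq> bot"
    by (simp add: trivial_limit_within islimpt_Icc)
  ultimately have "s (y - v) - (q y - q v) \<le> \<phi>' (y - v)"
    using lim tendsto_lowerbound by blast
  then show ?thesis by simp
qed

text \<open>
  The gradient inequality is the case in which the differentiable summand cancels the convex one,
  so that the zero functional is a subgradient of the sum.
\<close>

lemma convex_on_gradient_inequality:
  fixes f :: "'a::real_normed_vector \<Rightarrow> real"
  assumes "convex_on S f" "x \<in> S" "y \<in> S" "(f has_derivative f') (at x within S)"
  shows "f y \<ge> f x + f' (y - x)"
  using subgradient_of_convex_part[OF assms(1-3) has_derivative_minus[OF assms(4)], of 0]
  by simp

lemma proper_closed_convex_finite:
  assumes "proper_closed_convex \<psi>" "y \<in> edom \<psi>"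
  shows "\<psi> y = ereal (real_of_ereal (\<psi> y))"
  using assms by (cases "\<psi> y") (auto simp: proper_closed_convex_def edom_def)

lemma proper_closed_convex_convex_on:
  fixes \<psi> :: "'a::real_normed_vector \<Rightarrow> ereal"
  assumes "proper_closed_convex \<psi>"
  shows "convex_on (edom \<psi>) (\<lambda>x. real_of_ereal (\<psi> x))"
proof -
  let ?q = "\<lambda>x. real_of_ereal (\<psi> x)"
  have epi: "convex {(x, t::real). \<psi> x \<le> ereal t}"
    using assms by (simp add: proper_closed_convex_def)
  have mix: "\<psi> ((1 - t) *\<^sub>R x + t *\<^sub>R y) \<le> ereal ((1 - t) * ?q x + t * ?q y)"
    if "x \<in> edom \<psi>" "y \<in> edom \<psi>" "0 \<le> t" "t \<le> 1" for x y and t :: real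
  proof -
    have "(x, ?q x) \<in> {(x, t::real). \<psi> x \<le> ereal t}" "(y, ?q y) \<in> {(x, t::real). \<psi> x \<le> ereal t}"
      using that proper_closed_convex_finite[OF assms] by auto
    from convexD[OF epi this, of "1 - t" t] that show ?thesis by simp
  qed
  have mem: "(1 - t) *\<^sub>R x + t *\<^sub>R y \<in> edom \<psi>"
    if "x \<in> edom \<psi>" "y \<in> edom \<psi>" "0 \<le> t" "t \<le> 1" for x y and t :: real
    using mix[OF that] by (auto simp: edom_def less_top[symmetric] top_ereal_def)
  show ?thesis
  proof (rule convex_onI)
    show "convex (edom \<psi>)"
      by (auto simp: convex_alt mem)
    fix t :: real and x y assume "0 < t" "t < 1" "x \<in> edom \<psi>" "y \<in> edom \<psi>"
    then have "ereal (?q ((1 - t) *\<^sub>R x + t *\<^sub>R y)) \<le> ereal ((1 - t) * ?q x + t * ?q y)"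
      using mix[of x y t] proper_closed_convex_finite[OF assms mem[of x y t]] by simp
    then show "?q ((1 - t) *\<^sub>R x + t *\<^sub>R y) \<le> (1 - t) * ?q x + t * ?q y" by simp
  qed
qed

section \<open>One step of the method\<close>

lemma bregman_three_points:
  "bregman d gd u y = bregman d gd u v + bregman d gd v y + blinfun_apply (gd v - gd u) (y - v)"
  by (simp add: bregman_def blinfun.diff_left blinfun.diff_right)

lemma bregman_has_derivative:
  assumes "has_gradient_on d gd S" "v \<in> S"
  shows "(bregman d gd u has_derivative blinfun_apply (gd v - gd u)) (at v within S)"
proof -
  have d: "(d has_derivative blinfun_apply (gd v)) (at v within S)"
    using assms by (simp add: has_gradient_on_def)
  have "((\<lambda>y. d y - d u - blinfun_apply (gd u) (y - u)) has_derivative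
      (\<lambda>h. gd v h - 0 - gd u (h - 0))) (at v within S)"
    by (intro has_derivative_diff d has_derivative_const has_derivative_ident
        bounded_linear.has_derivative[OF blinfun.bounded_linear_right])
  then show ?thesis
    by (simp add: bregman_def[abs_def] blinfun.diff_left[abs_def])
qed

text \<open>
  The objective of the proximal subproblem with \<open>\<psi>\<close> replaced by its finite values \<open>q\<close>; it agrees
  with \<^const>\<open>contracted_objective\<close> on the effective domain.
\<close>

definition contracted_real ::
    "('a::real_normed_vector \<Rightarrow> real) \<Rightarrow> ('a \<Rightarrow> real) \<Rightarrow> ('a \<Rightarrow> real) \<Rightarrow> ('a \<Rightarrow> 'a \<Rightarrow>\<^sub>L real) \<Rightarrow>
     real \<Rightarrow> real \<Rightarrow> real \<Rightarrow> 'a \<Rightarrow> 'a \<Rightarrow> 'a \<Rightarrow> real" where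
  "contracted_real f q d gd a A \<gamma> x u y =
     (A + a) * f ((1 / (A + a)) *\<^sub>R (a *\<^sub>R y + A *\<^sub>R x)) + a * q y + \<gamma> * bregman d gd u y"

lemma contraction_mem:
  assumes "convex S" "y \<in> S" "x \<in> S" "a > 0" "A \<ge> (0::real)"
  shows "(1 / (A + a)) *\<^sub>R (a *\<^sub>R y + A *\<^sub>R x) \<in> S"
proof -
  have "(a / (A + a)) *\<^sub>R y + (A / (A + a)) *\<^sub>R x \<in> S"
    using assms by (intro convexD) (auto simp: add_divide_distrib[symmetric] add.commute)
  then show ?thesis by (simp add: scaleR_add_right)
qed

lemma convex_on_contraction:
  assumes f: "convex_on S f" and "y \<in> S" "x \<in> S" "a > 0" "A \<ge> (0::real)"
  shows "(A + a) * f ((1 / (A + a)) *\<^sub>R (a *\<^sub>R y + A *\<^sub>R x)) \<le> a * f y + A * f x"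
proof -
  have pos: "A + a > 0" using assms by simp
  have one: "1 - A / (A + a) = a / (A + a)" using pos by (simp add: field_simps)
  have "f ((1 - A / (A + a)) *\<^sub>R y + (A / (A + a)) *\<^sub>R x)
      \<le> (1 - A / (A + a)) * f y + (A / (A + a)) * f x"
    using assms by (intro convex_onD[OF f]) (auto simp: field_simps)
  then have "f ((1 / (A + a)) *\<^sub>R (a *\<^sub>R y + A *\<^sub>R x)) \<le> (a * f y + A * f x) / (A + a)"
    unfolding one by (simp add: scaleR_add_right add_divide_distrib)
  then show ?thesis using pos by (simp add: pos_le_divide_eq mult.commute)
qed

text \<open>
  Dividing by \<open>a\<close> what remains of \<open>s\<close> after removing the gradients of the two smooth summands
  gives a subgradient of \<open>q\<close> at \<open>v\<close>, to which the hypothesis on \<open>\<sigma>\<close> applies. Adding the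
  gradient inequality of \<open>f\<close> and the three-point identity puts the removed gradients back.
\<close>

lemma contracted_growth:
  fixes f q d :: "'a::real_normed_vector \<Rightarrow> real" and s :: "'a \<Rightarrow>\<^sub>L real"
  assumes f: "convex_on D f" "\<And>z. z \<in> D \<Longrightarrow> f differentiable (at z)"
    and q: "convex_on S q" and SD: "S \<subseteq> D"
    and d: "has_gradient_on d gd S"
    and rel: "\<And>g z. (\<And>y. y \<in> S \<Longrightarrow> q y \<ge> q v + blinfun_apply g (y - v)) \<Longrightarrow> z \<in> S \<Longrightarrow>
        q z \<ge> q v + blinfun_apply g (z - v) + \<sigma> * bregman d gd v z"
    and pos: "a > 0" "A \<ge> 0"
    and mem: "x \<in> S" "v \<in> S" "y \<in> S"
    and s: "\<And>z. z \<in> S \<Longrightarrow> contracted_real f q d gd a A \<gamma> x u z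
        \<ge> contracted_real f q d gd a A \<gamma> x u v + s (z - v)"
  shows "contracted_real f q d gd a A \<gamma> x u y
    \<ge> contracted_real f q d gd a A \<gamma> x u v + s (y - v) + (\<gamma> + a * \<sigma>) * bregman d gd v y"
proof -
  define B where "B = A + a"
  have B: "B > 0" using pos by (simp add: B_def)
  define c where "c z = (1 / B) *\<^sub>R (a *\<^sub>R z + A *\<^sub>R x)" for z
  have conv: "convex S" using q by (rule convex_on_imp_convex)
  have cD: "c z \<in> D" if "z \<in> S" for z
    using contraction_mem[OF conv that mem(1) pos] SD by (auto simp: c_def B_def)
  obtain f' where f': "(f has_derivative f') (at (c v))"
    using f(2)[OF cD[OF mem(2)]] by (auto simp: differentiable_def)
  define G where "G = Blinfun f'"
  have G: "(f has_derivative blinfun_apply G) (at (c v))"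
    using f' has_derivative_bounded_linear[OF f'] by (simp add: G_def bounded_linear_Blinfun_apply)
  have c': "(c has_derivative (\<lambda>h. (a / B) *\<^sub>R h)) (at v within S)"
    unfolding c_def by (auto intro!: derivative_eq_intros)
  have "((f \<circ> c) has_derivative (blinfun_apply G \<circ> (\<lambda>h. (a / B) *\<^sub>R h))) (at v within S)"
    using c' G by (intro diff_chain_within) (auto intro: has_derivative_at_withinI)
  then have "((\<lambda>z. B * f (c z)) has_derivative (\<lambda>h. B * G ((a / B) *\<^sub>R h))) (at v within S)"
    by (intro has_derivative_mult_right) (simp add: o_def)
  then have fc: "((\<lambda>z. B * f (c z)) has_derivative (\<lambda>h. a * G h)) (at v within S)"
    using B by (simp add: blinfun.scaleR_right)
  define smooth where "smooth z = B * f (c z) + \<gamma> * bregman d gd u z" for z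
  have smooth': "(smooth has_derivative (\<lambda>h. a * G h + \<gamma> * (gd v - gd u) h)) (at v within S)"
    unfolding smooth_def
    by (intro has_derivative_add fc has_derivative_mult_right bregman_has_derivative d mem)
  have h: "contracted_real f q d gd a A \<gamma> x u z = smooth z + a * q z" for z
    by (simp add: contracted_real_def smooth_def c_def B_def)
  define g where "g = (1 / a) *\<^sub>R (s - \<gamma> *\<^sub>R (gd v - gd u)) - G"
  have g: "a * g h = s h - \<gamma> * (gd v - gd u) h - a * G h" for h
    using pos by (simp add: g_def blinfun.bilinear_simps field_simps)
  have "q z \<ge> q v + g (z - v)" if z: "z \<in> S" for z
  proof -
    have "a * q z \<ge> a * q v + s (z - v) - (a * G (z - v) + \<gamma> * (gd v - gd u) (z - v))"
    proof (rule subgradient_of_convex_part[OF _ mem(2) z smooth'])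
      show "convex_on S (\<lambda>z. a * q z)"
        using q pos by (intro convex_on_cmul) auto
    qed (use s h in \<open>auto simp: algebra_simps\<close>)
    then have "a * (q v + g (z - v)) \<le> a * q z"
      by (simp add: distrib_left g)
    then show ?thesis using pos by simp
  qed
  from rel[OF this mem(3)]
  have "a * (q v + g (y - v) + \<sigma> * bregman d gd v y) \<le> a * q y"
    using pos by simp
  then have psi_part: "a * q y \<ge> a * q v + (s (y - v) - \<gamma> * (gd v - gd u) (y - v) - a * G (y - v))
      + a * \<sigma> * bregman d gd v y"
    by (simp add: distrib_left g)
  have "f (c y) \<ge> f (c v) + G (c y - c v)"
    by (rule convex_on_gradient_inequality[OF f(1)])
      (use cD mem G in \<open>auto intro: has_derivative_at_withinI\<close>)
  moreover have "c y - c v = (a / B) *\<^sub>R (y - v)"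
    by (simp add: c_def algebra_simps)
  ultimately have "B * (f (c v) + (a / B) * G (y - v)) \<le> B * f (c y)"
    using B by (simp add: blinfun.scaleR_right)
  then have f_part: "B * f (c y) \<ge> B * f (c v) + a * G (y - v)"
    using B by (simp add: distrib_left)
  have "\<gamma> * bregman d gd u y = \<gamma> * bregman d gd u v + \<gamma> * bregman d gd v y
      + \<gamma> * (gd v - gd u) (y - v)"
    by (subst bregman_three_points[of d gd u y v]) (simp add: distrib_left)
  with psi_part f_part show ?thesis
    by (simp add: h smooth_def distrib_right)
qed

text \<open>
  Comparing \<open>h\<^sub>k\<^sub>+\<^sub>1\<close> at \<open>v\<^sub>k\<^sub>+\<^sub>1\<close> and at \<open>y\<close>. At \<open>y\<close> convexity of \<open>f\<close> splits the value of \<open>f\<close> at the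
  contracted point; at \<open>v\<^sub>k\<^sub>+\<^sub>1\<close> the contracted point is \<open>x\<^sub>k\<^sub>+\<^sub>1\<close> itself, and convexity of \<open>q\<close>
  assembles \<open>q\<close> at \<open>x\<^sub>k\<^sub>+\<^sub>1\<close> from \<open>q\<close> at \<open>v\<^sub>k\<^sub>+\<^sub>1\<close> and \<open>x\<^sub>k\<close>.
\<close>

lemma contracting_step:
  fixes f q d :: "'a::real_normed_vector \<Rightarrow> real" and s :: "'a \<Rightarrow>\<^sub>L real"
  assumes f: "convex_on D f" "\<And>z. z \<in> D \<Longrightarrow> f differentiable (at z)"
    and q: "convex_on S q" and SD: "S \<subseteq> D"
    and d: "has_gradient_on d gd S"
    and rel: "\<And>g z. (\<And>y. y \<in> S \<Longrightarrow> q y \<ge> q v + blinfun_apply g (y - v)) \<Longrightarrow> z \<in> S \<Longrightarrow>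
        q z \<ge> q v + blinfun_apply g (z - v) + \<sigma> * bregman d gd v z"
    and pos: "a > 0" "A \<ge> 0"
    and mem: "x \<in> S" "v \<in> S" "y \<in> S"
    and s: "\<And>z. z \<in> S \<Longrightarrow> contracted_real f q d gd a A \<gamma> x u z
        \<ge> contracted_real f q d gd a A \<gamma> x u v + s (z - v)"
    and x': "x' = (1 / (A + a)) *\<^sub>R (a *\<^sub>R v + A *\<^sub>R x)"
  shows "(A + a) * (f x' + q x' - (f y + q y)) + (\<gamma> + a * \<sigma>) * bregman d gd v y
      + \<gamma> * bregman d gd u v
    \<le> A * (f x + q x - (f y + q y)) + \<gamma> * bregman d gd u y + norm s * norm (v - y)"
proof -
  have growth: "contracted_real f q d gd a A \<gamma> x u y
    \<ge> contracted_real f q d gd a A \<gamma> x u v + s (y - v) + (\<gamma> + a * \<sigma>) * bregman d gd v y"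
    by (rule contracted_growth[OF f q SD d rel pos mem s])
  have "(A + a) * f ((1 / (A + a)) *\<^sub>R (a *\<^sub>R y + A *\<^sub>R x)) \<le> a * f y + A * f x"
    using mem SD pos by (intro convex_on_contraction[OF f(1)]) auto
  moreover have "(A + a) * q x' \<le> a * q v + A * q x"
    unfolding x' using mem pos by (intro convex_on_contraction[OF q])
  moreover have "- s (y - v) \<le> norm s * norm (v - y)"
    using norm_blinfun[of s "y - v"] by (simp add: norm_minus_commute)
  ultimately show ?thesis
    using growth unfolding contracted_real_def x'[symmetric] distrib_right[of A a] right_diff_distrib
      distrib_left[of _ "f _"]
    by linarith
qed

section \<open>Accumulation of the errors\<close>

text \<open>
  Either \<open>E\<close> does not increase, or \<open>E\<close> to the power \<open>\<theta> - 1\<close> does not, and multiplying the recursion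
  by that power of the new value yields the claim.
\<close>

lemma implicit_recursion_step:
  fixes E E' c \<theta> :: real
  assumes nonneg: "E \<ge> 0" "c \<ge> 0" and \<theta>: "0 < \<theta>" "\<theta> \<le> 1"
    and E': "E' \<ge> 0" "E' \<le> E + c * E' powr (1 - \<theta>)"
  shows "E' powr \<theta> \<le> E powr \<theta> + c"
proof (cases "E' \<le> E")
  case True
  then have "E' powr \<theta> \<le> E powr \<theta>" using E' \<theta> by (intro powr_mono2) auto
  with nonneg show ?thesis by simp
next
  case False
  then have pos: "E' > 0" using nonneg by simp
  have "E' powr \<theta> = E' * E' powr (\<theta> - 1)"
    using pos by (simp add: powr_mult_base)
  also have "\<dots> \<le> (E + c * E' powr (1 - \<theta>)) * E' powr (\<theta> - 1)"
    using E' by (intro mult_right_mono) auto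
  also have "\<dots> = E * E' powr (\<theta> - 1) + c"
    using pos by (simp add: distrib_right powr_add[symmetric] mult.assoc)
  also have "E * E' powr (\<theta> - 1) \<le> E powr \<theta>"
  proof (cases "E = 0")
    case False
    then have "E * E' powr (\<theta> - 1) \<le> E * E powr (\<theta> - 1)"
      using \<open>\<not> E' \<le> E\<close> nonneg \<theta> by (intro mult_left_mono powr_mono2') auto
    also have "\<dots> = E powr \<theta>" using nonneg False by (simp add: powr_mult_base)
    finally show ?thesis .
  qed simp
  finally show ?thesis by simp
qed

lemma implicit_recursion_bound:
  fixes E c :: "nat \<Rightarrow> real"
  assumes "\<And>k. E k \<ge> 0" "\<And>k. c (Suc k) \<ge> 0" "0 < \<theta>" "\<theta> \<le> 1"
    and "\<And>k. E (Suc k) \<le> E k + c (Suc k) * E (Suc k) powr (1 - \<theta>)"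
  shows "E k powr \<theta> \<le> E 0 powr \<theta> + (\<Sum>i=1..k. c i)"
proof (induction k)
  case (Suc k)
  have "E (Suc k) powr \<theta> \<le> E k powr \<theta> + c (Suc k)"
    by (rule implicit_recursion_step) (use assms in auto)
  with Suc show ?case by simp
qed simp

text \<open>
  Here \<open>b\<close> stands for the divergence from an iterate to the minimizer and \<open>n\<close> for their distance, so
  that the last hypothesis is uniform convexity. The conclusion makes the error term of a step a
  power of the potential itself.
\<close>

lemma uniform_convexity_distance_bound:
  fixes p \<sigma>p \<gamma> b n E :: real
  assumes pos: "p > 0" "\<sigma>p > 0" "\<gamma> > 0" "n \<ge> 0"
    and E: "\<gamma> * b \<le> E" and b: "\<sigma>p / (p + 1) * n powr (p + 1) \<le> b"
  shows "n \<le> ((p + 1) / \<sigma>p) powr (1 / (p + 1)) / \<gamma> powr (1 / (p + 1)) * E powr (1 / (p + 1))"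
proof -
  have "n powr (p + 1) \<le> (p + 1) / \<sigma>p * b"
    using b pos by (simp add: field_simps)
  also have "\<dots> \<le> (p + 1) / \<sigma>p * (E / \<gamma>)"
    using E pos by (intro mult_left_mono) (auto simp: field_simps)
  finally have le: "n powr (p + 1) \<le> (p + 1) / \<sigma>p * (E / \<gamma>)" .
  have "0 \<le> \<sigma>p / (p + 1) * n powr (p + 1)" using pos by simp
  with b have "0 \<le> b" by linarith
  then have "0 \<le> \<gamma> * b" using pos by simp
  with E have E0: "0 \<le> E" by linarith
  have "n = (n powr (p + 1)) powr (1 / (p + 1))"
    using pos by (simp add: powr_powr)
  also have "\<dots> \<le> ((p + 1) / \<sigma>p * (E / \<gamma>)) powr (1 / (p + 1))"
    using le pos by (intro powr_mono2) auto
  also have "\<dots> = ((p + 1) / \<sigma>p) powr (1 / (p + 1)) * (E powr (1 / (p + 1)) / \<gamma> powr (1 / (p + 1)))"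
    using pos E0 by (subst powr_mult) (auto simp: powr_divide)
  finally show ?thesis by (simp add: mult_ac)
qed

section \<open>Convergence of the method\<close>

theorem theorem3p2:
  fixes f :: "'a::real_normed_vector \<Rightarrow> real" and domf :: "'a set"
    and \<psi> :: "'a \<Rightarrow> ereal"
    and d :: "'a \<Rightarrow> real" and gd :: "'a \<Rightarrow> 'a \<Rightarrow>\<^sub>L real"
    and \<sigma> \<sigma>p p :: real and r :: nat
    and xs :: 'a and x v :: "nat \<Rightarrow> 'a" and a A \<gamma> \<delta> :: "nat \<Rightarrow> real"
  assumes finite_dim: "\<exists>B::'a set. finite B \<and> span B = UNIV"
    and f_dom: "open domf" and f_convex: "convex_on domf f"
    and f_diff: "r \<ge> 1" "times_differentiable_on r f domf"
    and psi: "proper_closed_convex \<psi>"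
    and dom_sub: "edom \<psi> \<subseteq> domf"
    and minimizer: "xs \<in> edom (objective f \<psi>)" "\<And>y. objective f \<psi> xs \<le> objective f \<psi> y"
    and d_diff: "has_gradient_on d gd (edom \<psi>)"
    and d_convex: "strictly_convex_on (edom \<psi>) d"
    and sigma_nonneg: "\<sigma> \<ge> 0"
    and sigma: "\<And>y z g. y \<in> edom \<psi> \<Longrightarrow> z \<in> edom \<psi> \<Longrightarrow> g \<in> subdifferential \<psi> y \<Longrightarrow>
        \<psi> z - \<psi> y - ereal (blinfun_apply g (z - y)) \<ge> ereal (\<sigma> * bregman d gd y z)"
    and p: "p \<ge> 1" and sigmap: "\<sigma>p > 0"
    and d_unif_convex: "\<And>y z. y \<in> edom \<psi> \<Longrightarrow> z \<in> edom \<psi> \<Longrightarrow>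
        bregman d gd y z \<ge> \<sigma>p / (p + 1) * norm (y - z) powr (p + 1)"
    and iterates: "contracting_proximal_method f \<psi> d gd \<sigma> \<delta> a A \<gamma> x v"
  shows "\<forall>k. ereal (A k) * (objective f \<psi> (x k) - objective f \<psi> xs)
           + ereal (\<gamma> k * bregman d gd (v k) xs)
           + ereal (\<Sum>i=1..k. \<gamma> (i - 1) * bregman d gd (v (i - 1)) (v i))
         \<le> ereal (((\<gamma> 0 * bregman d gd (x 0) xs) powr (p / (p + 1))
             + ((p + 1) / \<sigma>p) powr (1 / (p + 1)) * (\<Sum>i=1..k. \<delta> i / \<gamma> i powr (1 / (p + 1))))
             powr ((p + 1) / p))"
proof
  fix k
  define S where "S = edom \<psi>"
  define q where "q y = real_of_ereal (\<psi> y)" for y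
  have fin: "\<psi> y = ereal (q y)" if "y \<in> S" for y
    using proper_closed_convex_finite[OF psi] that by (simp add: S_def q_def)
  have inf: "\<psi> y = \<infinity>" if "y \<notin> S" for y
    using that by (simp add: S_def edom_def)
  have q: "convex_on S q"
    using proper_closed_convex_convex_on[OF psi] by (simp add: S_def q_def[abs_def])
  have conv: "convex S" using q by (rule convex_on_imp_convex)
  have f_differentiable: "f differentiable (at z)" if "z \<in> domf" for z
    using f_diff that by (cases r) auto
  have xs: "xs \<in> S"
    using minimizer(1) by (cases "\<psi> xs") (auto simp: S_def edom_def objective_def)

  have start: "x 0 \<in> S" "\<gamma> 0 > 0" "v 0 = x 0" "A 0 = 0"
    using iterates by (auto simp: contracting_proximal_method_def S_def)
  have step: "a (Suc k) > 0" "A (Suc k) = A k + a (Suc k)" "\<delta> (Suc k) \<ge> 0" "v (Suc k) \<in> S"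
      "x (Suc k) = (1 / A (Suc k)) *\<^sub>R (a (Suc k) *\<^sub>R v (Suc k) + A k *\<^sub>R x k)"
      "\<gamma> (Suc k) = \<gamma> k + a (Suc k) * \<sigma>" for k
    using iterates unfolding contracting_proximal_method_def S_def by blast+
  have inexact: "\<exists>s \<in> subdifferential
      (contracted_objective f \<psi> d gd (a (Suc k)) (A k) (\<gamma> k) (x k) (v k)) (v (Suc k)).
      norm s \<le> \<delta> (Suc k)" for k
    using iterates unfolding contracting_proximal_method_def by blast
  have A: "A k \<ge> 0" for k
    by (induction k) (use start step in \<open>auto simp: less_imp_le\<close>)
  have \<gamma>: "\<gamma> k > 0" for k
    by (induction k) (use start step sigma_nonneg in \<open>auto intro!: add_pos_nonneg simp: less_imp_le\<close>)
  have x: "x k \<in> S" for k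
  proof (induction k)
    case (Suc k)
    then show ?case
      using contraction_mem[OF conv step(4) Suc step(1) A] by (simp add: step(2,5))
  qed (use start in simp)
  have v: "v k \<in> S" for k
    by (cases k) (use start step in auto)
  have unif: "\<sigma>p / (p + 1) * norm (y - z) powr (p + 1) \<le> bregman d gd y z"
    if "y \<in> S" "z \<in> S" for y z
    using d_unif_convex that by (simp add: S_def)
  have bregman_nonneg: "bregman d gd y z \<ge> 0" if "y \<in> S" "z \<in> S" for y z
  proof -
    have "0 \<le> \<sigma>p / (p + 1) * norm (y - z) powr (p + 1)" using p sigmap by simp
    with unif[OF that] show ?thesis by linarith
  qed
  have rel: "q z \<ge> q u + blinfun_apply g (z - u) + \<sigma> * bregman d gd u z"
    if g: "\<And>y. y \<in> S \<Longrightarrow> q y \<ge> q u + blinfun_apply g (y - u)" and "u \<in> S" "z \<in> S" for u z g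
  proof -
    have "\<psi> y \<ge> \<psi> u + ereal (blinfun_apply g (y - u))" for y
      by (cases "y \<in> S") (use fin inf g \<open>u \<in> S\<close> in auto)
    then have "g \<in> subdifferential \<psi> u" by (simp add: subdifferential_def)
    from sigma[OF _ _ this, of z] that fin show ?thesis by (simp add: S_def)
  qed

  define E where "E k = A k * (f (x k) + q (x k) - (f xs + q xs)) + \<gamma> k * bregman d gd (v k) xs
      + (\<Sum>i=1..k. \<gamma> (i - 1) * bregman d gd (v (i - 1)) (v i))" for k
  have gap: "f (x k) + q (x k) - (f xs + q xs) \<ge> 0" for k
    using minimizer(2)[of "x k"] by (simp add: objective_def fin x xs)
  have path: "(\<Sum>i=1..k. \<gamma> (i - 1) * bregman d gd (v (i - 1)) (v i)) \<ge> 0" for k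
    using \<gamma> v by (intro sum_nonneg mult_nonneg_nonneg bregman_nonneg) (auto simp: less_imp_le)
  have weighted: "\<gamma> k * bregman d gd (v k) xs \<le> E k" for k
    using mult_nonneg_nonneg[OF A gap, of k] path[of k] by (simp add: E_def)
  have E_nonneg: "E k \<ge> 0" for k
    using weighted[of k] mult_nonneg_nonneg[OF less_imp_le[OF \<gamma>] bregman_nonneg[OF v xs], of k k]
    by linarith

  have descent: "E (Suc k) \<le> E k + \<delta> (Suc k) * norm (v (Suc k) - xs)" for k
  proof -
    let ?h = "contracted_real f q d gd (a (Suc k)) (A k) (\<gamma> k) (x k) (v k)"
    obtain s where sub: "s \<in> subdifferential
        (contracted_objective f \<psi> d gd (a (Suc k)) (A k) (\<gamma> k) (x k) (v k)) (v (Suc k))"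
      and s\<delta>: "norm s \<le> \<delta> (Suc k)" using inexact by blast
    have h: "contracted_objective f \<psi> d gd (a (Suc k)) (A k) (\<gamma> k) (x k) (v k) z = ereal (?h z)"
      if "z \<in> S" for z
      using fin[OF that] by (simp add: contracted_objective_def contracted_real_def)
    have s: "?h z \<ge> ?h (v (Suc k)) + s (z - v (Suc k))" if "z \<in> S" for z
    proof -
      have "ereal (?h (v (Suc k))) + ereal (s (z - v (Suc k))) \<le> ereal (?h z)"
        using sub h[OF that] h[OF v[of "Suc k"]] by (auto simp: subdifferential_def dest: spec[of _ z])
      then show ?thesis by simp
    qed
    have "(A k + a (Suc k)) * (f (x (Suc k)) + q (x (Suc k)) - (f xs + q xs))
        + (\<gamma> k + a (Suc k) * \<sigma>) * bregman d gd (v (Suc k)) xs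
        + \<gamma> k * bregman d gd (v k) (v (Suc k))
      \<le> A k * (f (x k) + q (x k) - (f xs + q xs)) + \<gamma> k * bregman d gd (v k) xs
        + norm s * norm (v (Suc k) - xs)"
    proof (rule contracting_step[OF f_convex f_differentiable q])
      show "S \<subseteq> domf" using dom_sub by (simp add: S_def)
      show "has_gradient_on d gd S" using d_diff by (simp add: S_def)
      show "x (Suc k) = (1 / (A k + a (Suc k))) *\<^sub>R (a (Suc k) *\<^sub>R v (Suc k) + A k *\<^sub>R x k)"
        using step(5)[of k] by (simp add: step(2))
    qed (use s rel v x xs A step(1) in auto)
    moreover have "norm s * norm (v (Suc k) - xs) \<le> \<delta> (Suc k) * norm (v (Suc k) - xs)"
      using s\<delta> by (simp add: mult_right_mono)
    ultimately show ?thesis by (simp add: E_def step(2,6))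
  qed

  let ?C = "((p + 1) / \<sigma>p) powr (1 / (p + 1))"
  define c where "c i = ?C * (\<delta> i / \<gamma> i powr (1 / (p + 1)))" for i
  have \<theta>: "1 - p / (p + 1) = 1 / (p + 1)" using p by (simp add: field_simps)
  have "E (Suc k) \<le> E k + c (Suc k) * E (Suc k) powr (1 - p / (p + 1))" for k
  proof -
    have "norm (v (Suc k) - xs)
        \<le> ?C / \<gamma> (Suc k) powr (1 / (p + 1)) * E (Suc k) powr (1 / (p + 1))"
      using p sigmap \<gamma> weighted unif[OF v xs]
      by (intro uniform_convexity_distance_bound) auto
    then have "\<delta> (Suc k) * norm (v (Suc k) - xs)
        \<le> \<delta> (Suc k) * (?C / \<gamma> (Suc k) powr (1 / (p + 1)) * E (Suc k) powr (1 / (p + 1)))"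
      using step(3) by (intro mult_left_mono) auto
    also have "\<dots> = c (Suc k) * E (Suc k) powr (1 / (p + 1))"
      by (simp add: c_def mult_ac)
    finally show ?thesis using descent[of k] by (simp add: \<theta>)
  qed
  then have "E k powr (p / (p + 1)) \<le> E 0 powr (p / (p + 1)) + (\<Sum>i=1..k. c i)"
    using E_nonneg p step(3) by (intro implicit_recursion_bound) (auto simp: c_def)
  moreover have "E 0 = \<gamma> 0 * bregman d gd (x 0) xs"
    by (simp add: E_def start)
  ultimately have bound: "E k powr (p / (p + 1)) \<le> (\<gamma> 0 * bregman d gd (x 0) xs) powr (p / (p + 1))
      + ?C * (\<Sum>i=1..k. \<delta> i / \<gamma> i powr (1 / (p + 1)))"
    by (simp add: c_def sum_distrib_left)
  have "E k = (E k powr (p / (p + 1))) powr ((p + 1) / p)"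
    using p E_nonneg by (simp add: powr_powr)
  also have "\<dots> \<le> ((\<gamma> 0 * bregman d gd (x 0) xs) powr (p / (p + 1))
      + ?C * (\<Sum>i=1..k. \<delta> i / \<gamma> i powr (1 / (p + 1)))) powr ((p + 1) / p)"
    using bound p by (intro powr_mono2) auto
  finally show "ereal (A k) * (objective f \<psi> (x k) - objective f \<psi> xs)
           + ereal (\<gamma> k * bregman d gd (v k) xs)
           + ereal (\<Sum>i=1..k. \<gamma> (i - 1) * bregman d gd (v (i - 1)) (v i))
         \<le> ereal (((\<gamma> 0 * bregman d gd (x 0) xs) powr (p / (p + 1))
             + ((p + 1) / \<sigma>p) powr (1 / (p + 1)) * (\<Sum>i=1..k. \<delta> i / \<gamma> i powr (1 / (p + 1))))
             powr ((p + 1) / p))"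
    by (simp add: objective_def fin x xs E_def)
qed

end
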